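(* Let $\lambda\in(2/3,1)$ and define the two-qubit states $\rho_\lambda=\lambda\,\Phi_1+(1-\lambda)\,|01\rangle\langle 01|$ and $\sigma_\lambda=\lambda\,\Phi_1+(1-\lambda)\,\Phi_3$, where $\Phi_1=|\Phi_1\rangle\langle\Phi_1|$ and $\Phi_3=|\Phi_3\rangle\langle\Phi_3|$ with $|\Phi_1\rangle=\frac{1}{\sqrt2}(|00\rangle+|11\rangle)$ and $|\Phi_3\rangle=\frac{1}{\sqrt2}(|10\rangle+|01\rangle)$. Then there is no non-entangling (NE) map $\Lambda$ on two-qubit states such that $\Lambda(\rho_\lambda)=\sigma_\lambda$.
   Context: $\mathcal{D}$ denotes the set of two-qubit states, i.e. $4\times4$ unit-trace Hermitian positive semidefinite complex matrices acting on $\mathbb{C}^2\otimes\mathbb{C}^2$. With $\{|0\rangle,|1\rangle\}$ the standard basis of $\mathbb{C}^2$, write $|ij\rangle=|i\rangle\otimes|j\rangle$. $\mathcal{S}\subset\mathcal{D}$ denotes the set of separable states, i.e. those $\rho\in\mathcal{D}$ that can be written as $\rho=\sum_i p_i|\psi_i\rangle\langle\psi_i|\otimes|\chi_i\rangle\langle\chi_i|$ for some convex weights $\{p_i\}$ and unit vectors $|\psi_i\rangle,|\chi_i\rangle\in\mathbb{C}^2$. A completely positive and trace-preserving (linear) map $\Lambda$ on $4\times 4$ complex matrices, viewed as a map $\mathcal{D}\to\mathcal{D}$, is non-entangling (NE) if $\Lambda(\rho)\in\mathcal{S}$ for all $\rho\in\mathcal{S}$. *)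

theory Defs
  imports "HOL-Analysis.Analysis"
begin

text \<open>
  Two-qubit vectors and operators are indexed by \<open>2 \<times> 2\<close>: the component at \<open>(i, j)\<close>
  is the coefficient of \<open>|ij>\<close>, where \<open>i\<close> and \<open>j\<close> range over the elements \<open>0\<close> and \<open>1\<close>
  of the numeral type \<open>2\<close>.
\<close>

type_synonym qubit_vec = "complex ^ 2"
type_synonym qubit_mat = "complex ^ 2 ^ 2"
type_synonym two_qubit_vec = "complex ^ (2 \<times> 2)"
type_synonym two_qubit_mat = "complex ^ (2 \<times> 2) ^ (2 \<times> 2)"

definition cinner :: "complex ^ 'n \<Rightarrow> complex ^ 'n \<Rightarrow> complex" where
  "cinner u v = (\<Sum>i\<in>UNIV. cnj (u $ i) * v $ i)"

definition conj_transpose :: "complex ^ 'n ^ 'm \<Rightarrow> complex ^ 'm ^ 'n" where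
  "conj_transpose A = (\<chi> i j. cnj (A $ j $ i))"

definition hermitian :: "complex ^ 'n ^ 'n \<Rightarrow> bool" where
  "hermitian A \<longleftrightarrow> conj_transpose A = A"

definition psd :: "complex ^ 'n ^ 'n \<Rightarrow> bool" where
  "psd A \<longleftrightarrow> hermitian A \<and> (\<forall>v. cinner v (A *v v) \<in> \<real>\<^sub>\<ge>\<^sub>0)"

text \<open>The rank-one operator \<open>|v><v|\<close>.\<close>

definition proj :: "complex ^ 'n \<Rightarrow> complex ^ 'n ^ 'n" where
  "proj v = (\<chi> i j. v $ i * cnj (v $ j))"

definition tensor_vec :: "qubit_vec \<Rightarrow> qubit_vec \<Rightarrow> two_qubit_vec" where
  "tensor_vec u v = (\<chi> p. u $ fst p * v $ snd p)"

definition tensor_mat :: "qubit_mat \<Rightarrow> qubit_mat \<Rightarrow> two_qubit_mat" where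
  "tensor_mat A B = (\<chi> p q. A $ fst p $ fst q * B $ snd p $ snd q)"

definition two_qubit_states :: "two_qubit_mat set" where
  "two_qubit_states = {\<rho>. psd \<rho> \<and> trace \<rho> = 1}"

definition separable_states :: "two_qubit_mat set" where
  "separable_states = {\<rho> \<in> two_qubit_states.
     \<exists>(n::nat) (p :: nat \<Rightarrow> real) (\<psi> :: nat \<Rightarrow> qubit_vec) (\<chi>' :: nat \<Rightarrow> qubit_vec).
       (\<forall>i<n. 0 \<le> p i) \<and> (\<Sum>i<n. p i) = 1 \<and>
       (\<forall>i<n. norm (\<psi> i) = 1 \<and> norm (\<chi>' i) = 1) \<and>
       \<rho> = (\<Sum>i<n. p i *\<^sub>R tensor_mat (proj (\<psi> i)) (proj (\<chi>' i)))}"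

definition complex_linear :: "(two_qubit_mat \<Rightarrow> two_qubit_mat) \<Rightarrow> bool" where
  "complex_linear \<Lambda> \<longleftrightarrow>
     (\<forall>A B. \<Lambda> (A + B) = \<Lambda> A + \<Lambda> B) \<and>
     (\<forall>c A. \<Lambda> (map_matrix ((*) c) A) = map_matrix ((*) c) (\<Lambda> A))"

text \<open>
  An operator on \<open>\<complex>\<^sup>n \<otimes> (\<complex>\<^sup>2 \<otimes> \<complex>\<^sup>2)\<close> is given by its \<open>n \<times> n\<close> array \<open>X\<close> of two-qubit
  blocks; only \<open>X i j\<close> with \<open>i, j < n\<close> matter. A vector of that space is a family \<open>v\<close> of
  \<open>n\<close> two-qubit vectors. On blocks, the ampliation \<open>id\<^sub>n \<otimes> \<Lambda>\<close> acts as \<open>\<lambda>i j. \<Lambda> (X i j)\<close>, so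
  that \<open>completely_positive \<Lambda>\<close> says that \<open>id\<^sub>n \<otimes> \<Lambda>\<close> preserves positivity for every \<open>n\<close>.
\<close>

definition block_psd :: "nat \<Rightarrow> (nat \<Rightarrow> nat \<Rightarrow> two_qubit_mat) \<Rightarrow> bool" where
  "block_psd n X \<longleftrightarrow>
     (\<forall>i<n. \<forall>j<n. conj_transpose (X j i) = X i j) \<and>
     (\<forall>v :: nat \<Rightarrow> two_qubit_vec.
        (\<Sum>i<n. \<Sum>j<n. cinner (v i) (X i j *v v j)) \<in> \<real>\<^sub>\<ge>\<^sub>0)"

definition completely_positive :: "(two_qubit_mat \<Rightarrow> two_qubit_mat) \<Rightarrow> bool" where
  "completely_positive \<Lambda> \<longleftrightarrow> (\<forall>n X. block_psd n X \<longrightarrow> block_psd n (\<lambda>i j. \<Lambda> (X i j)))"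

definition trace_preserving :: "(two_qubit_mat \<Rightarrow> two_qubit_mat) \<Rightarrow> bool" where
  "trace_preserving \<Lambda> \<longleftrightarrow> (\<forall>X. trace (\<Lambda> X) = trace X)"

definition non_entangling :: "(two_qubit_mat \<Rightarrow> two_qubit_mat) \<Rightarrow> bool" where
  "non_entangling \<Lambda> \<longleftrightarrow>
     complex_linear \<Lambda> \<and> completely_positive \<Lambda> \<and> trace_preserving \<Lambda> \<and>
     (\<forall>\<rho> \<in> separable_states. \<Lambda> \<rho> \<in> separable_states)"

definition ket :: "2 \<Rightarrow> 2 \<Rightarrow> two_qubit_vec" where
  "ket i j = tensor_vec (axis i 1) (axis j 1)"

definition Phi1 :: two_qubit_vec where
  "Phi1 = (1 / sqrt 2) *\<^sub>R (ket 0 0 + ket 1 1)"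

definition Phi3 :: two_qubit_vec where
  "Phi3 = (1 / sqrt 2) *\<^sub>R (ket 1 0 + ket 0 1)"

definition rho_state :: "real \<Rightarrow> two_qubit_mat" where
  "rho_state l = l *\<^sub>R proj Phi1 + (1 - l) *\<^sub>R proj (ket 0 1)"

definition sigma_state :: "real \<Rightarrow> two_qubit_mat" where
  "sigma_state l = l *\<^sub>R proj Phi1 + (1 - l) *\<^sub>R proj Phi3"

end

theory Submission
  imports Defs
begin

text \<open>
  The functionals \<open>W\<^sub>1(X) = X\<^bsub>01,01\<^esub> + X\<^bsub>10,10\<^esub> - 2 Re X\<^bsub>00,11\<^esub>\<close> and
  \<open>W\<^sub>2(X) = X\<^bsub>00,00\<^esub> + X\<^bsub>11,11\<^esub> - 2 Re X\<^bsub>01,10\<^esub>\<close> are nonnegative on separable states, and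
  \<open>W\<^sub>1 + W\<^sub>2\<close> is nonnegative on all states. Suppose that \<open>\<Lambda>\<close> maps \<open>\<rho>\<^sub>\<lambda>\<close> to \<open>\<sigma>\<^sub>\<lambda>\<close>. As \<open>W\<^sub>1 + W\<^sub>2\<close>
  vanishes on \<open>\<sigma>\<^sub>\<lambda>\<close>, it vanishes on \<open>\<Lambda>(|01><01|)\<close>; this state is separable, so \<open>W\<^sub>1\<close> vanishes
  there too, and hence \<open>\<lambda> W\<^sub>1(\<Lambda>(\<Phi>\<^sub>1)) = W\<^sub>1(\<sigma>\<^sub>\<lambda>) = 1 - 2\<lambda> < 0\<close>. On the other hand
  \<open>2 p\<^sup>2 q\<^sup>2 \<Phi>\<^sub>1 + p\<^sup>4 |01><01| + q\<^sup>4 |10><10|\<close> is separable whenever \<open>p\<^sup>2 + q\<^sup>2 = 1\<close>, so that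
  \<open>2 p\<^sup>2 W\<^sub>1(\<Lambda>(\<Phi>\<^sub>1)) + q\<^sup>2 W\<^sub>1(\<Lambda>(|10><10|)) \<ge> 0\<close>; letting \<open>q\<close> tend to \<open>0\<close> gives
  \<open>W\<^sub>1(\<Lambda>(\<Phi>\<^sub>1)) \<ge> 0\<close>, a contradiction.
\<close>

section \<open>Entrywise computation over the index type\<close>

lemma cases_2: "(i::2) = 0 \<or> i = 1"
  using exhaust_2[of i] by auto

lemma UNIV_2_zero_one: "(UNIV :: 2 set) = {0, 1}"
  using cases_2 by blast

lemma sum_2x2:
  fixes f :: "2 \<times> 2 \<Rightarrow> 'a::comm_monoid_add"
  shows "sum f UNIV = f (0,0) + f (0,1) + f (1,0) + f (1,1)"
proof -
  have "sum f UNIV = (\<Sum>i\<in>UNIV. \<Sum>j\<in>UNIV. f (i, j))"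
    by (simp add: sum.cartesian_product flip: UNIV_Times_UNIV)
  then show ?thesis
    by (simp add: UNIV_2_zero_one add.assoc)
qed

lemma matrix_eq_2x2I:
  fixes A B :: two_qubit_mat
  assumes "\<And>i j k l. A $ (i, j) $ (k, l) = B $ (i, j) $ (k, l)"
  shows "A = B"
  using assms by (auto simp: vec_eq_iff)

section \<open>Positive operators and their images under the map\<close>

lemma psd_proj: "psd (proj v)"
proof -
  have "cinner w (proj v *v w) = cinner w v * cnj (cinner w v)" for w
    unfolding cinner_def proj_def matrix_vector_mult_def
    by (subst mult.commute) (simp add: sum_product sum_distrib_left mult_ac, rule sum.swap)
  moreover have "z * cnj z \<in> \<real>\<^sub>\<ge>\<^sub>0" for z
    by (simp add: complex_mult_cnj complex_nonneg_Reals_iff)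
  ultimately show ?thesis
    by (simp add: psd_def hermitian_def conj_transpose_def proj_def vec_eq_iff)
qed

lemma psd_add:
  assumes "psd A" "psd B"
  shows "psd (A + B)"
  using assms
  by (auto simp: psd_def hermitian_def conj_transpose_def vec_eq_iff cinner_def
      matrix_vector_mult_add_rdistrib distrib_left sum.distrib nonneg_Reals_add_I)

lemma psd_scaleR:
  assumes "psd A" "0 \<le> r"
  shows "psd (r *\<^sub>R A)"
proof -
  have "cinner v ((r *\<^sub>R A) *v v) = of_real r * cinner v (A *v v)" for v
    by (simp add: cinner_def matrix_vector_mult_def sum_distrib_left
        scaleR_conv_of_real[where 'a=complex] mult_ac)
  then show ?thesis
    using assms
    by (auto simp: psd_def hermitian_def conj_transpose_def vec_eq_iff nonneg_Reals_mult_I)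
qed

lemma completely_positive_psd:
  assumes "completely_positive \<Lambda>" "psd X"
  shows "psd (\<Lambda> X)"
proof -
  have *: "block_psd 1 (\<lambda>_ _. Y) \<longleftrightarrow> psd Y" for Y
  proof -
    \<comment> \<open>With a single block only the value at index 0 of a family of vectors matters,
      and every vector is the value of a constant family.\<close>
    have "(\<forall>v::nat \<Rightarrow> two_qubit_vec. cinner (v 0) (Y *v v 0) \<in> \<real>\<^sub>\<ge>\<^sub>0)
        \<longleftrightarrow> (\<forall>v. cinner v (Y *v v) \<in> \<real>\<^sub>\<ge>\<^sub>0)"
    proof (intro iffI allI)
      fix v :: two_qubit_vec
      assume "\<forall>v::nat \<Rightarrow> two_qubit_vec. cinner (v 0) (Y *v v 0) \<in> \<real>\<^sub>\<ge>\<^sub>0"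
      from this[rule_format, of "\<lambda>_. v"] show "cinner v (Y *v v) \<in> \<real>\<^sub>\<ge>\<^sub>0" .
    qed simp
    then show ?thesis
      by (simp add: block_psd_def psd_def hermitian_def)
  qed
  show ?thesis
    using assms(1)[unfolded completely_positive_def, rule_format, of 1 "\<lambda>_ _. X"] assms(2) *
    by simp
qed

lemma complex_linear_scaleR:
  assumes "complex_linear \<Lambda>"
  shows "\<Lambda> (r *\<^sub>R A) = r *\<^sub>R \<Lambda> A"
proof -
  have "map_matrix ((*) (complex_of_real r)) B = r *\<^sub>R B" for B :: two_qubit_mat
    by (simp add: vec_eq_iff map_matrix_def scaleR_conv_of_real[where 'a=complex])
  then show ?thesis
    using assms unfolding complex_linear_def by metis
qed

section \<open>Entanglement witnesses\<close>

text \<open>For Hermitian \<open>X\<close> this is \<open><w|Y|w>\<close>, where \<open>Y\<close> is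
  the partial transpose of \<open>X\<close> and \<open>w = |01> - |10>\<close>;
  \<open>witness2\<close> is the same with \<open>w = |00> - |11>\<close>.\<close>

definition witness1 :: "two_qubit_mat \<Rightarrow> real" where
  "witness1 X = Re (X $ (0,1) $ (0,1)) + Re (X $ (1,0) $ (1,0)) - 2 * Re (X $ (0,0) $ (1,1))"

definition witness2 :: "two_qubit_mat \<Rightarrow> real" where
  "witness2 X = Re (X $ (0,0) $ (0,0)) + Re (X $ (1,1) $ (1,1)) - 2 * Re (X $ (0,1) $ (1,0))"

lemma linear_witness1: "linear witness1"
  by (rule linearI) (simp_all add: witness1_def algebra_simps)

lemma linear_witness2: "linear witness2"
  by (rule linearI) (simp_all add: witness2_def algebra_simps)

lemma Re_mult_cnj_le: "2 * Re (a * cnj b) \<le> (cmod a)\<^sup>2 + (cmod b)\<^sup>2"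
proof -
  have "0 \<le> (Re a - Re b)\<^sup>2 + (Im a - Im b)\<^sup>2" by simp
  then show ?thesis
    by (simp add: cmod_power2 power2_diff algebra_simps)
qed

text \<open>Partial transposition conjugates the second factor, so on a product each witness is a
  square \<open>|a - b|^2\<close>, where \<open>a\<close> and \<open>b\<close> are products of
  components of \<open>u\<close> and of the conjugate of \<open>v\<close>.\<close>

lemma
  fixes u v :: qubit_vec
  shows witness1_product: "0 \<le> witness1 (tensor_mat (proj u) (proj v))"
    and witness2_product: "0 \<le> witness2 (tensor_mat (proj u) (proj v))"
proof -
  have sq: "Re (a * cnj a * (b * cnj b)) = (cmod (a * b))\<^sup>2" for a b
  proof -
    have "a * cnj a * (b * cnj b) = of_real ((cmod (a * b))\<^sup>2)"
      unfolding complex_norm_square by (simp add: mult_ac)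
    then show ?thesis by (simp only: Re_complex_of_real)
  qed
  have "witness1 (tensor_mat (proj u) (proj v)) = (cmod (u $ 0 * v $ 1))\<^sup>2 + (cmod (u $ 1 * v $ 0))\<^sup>2
      - 2 * Re ((u $ 0 * cnj (v $ 1)) * cnj (u $ 1 * cnj (v $ 0)))"
    unfolding sq[symmetric] by (simp only: witness1_def tensor_mat_def proj_def vec_lambda_beta
        fst_conv snd_conv complex_cnj_mult complex_cnj_cnj mult_ac)
  then show "0 \<le> witness1 (tensor_mat (proj u) (proj v))"
    using Re_mult_cnj_le[of "u $ 0 * cnj (v $ 1)" "u $ 1 * cnj (v $ 0)"]
    unfolding norm_mult complex_mod_cnj by linarith
  have "witness2 (tensor_mat (proj u) (proj v)) = (cmod (u $ 0 * v $ 0))\<^sup>2 + (cmod (u $ 1 * v $ 1))\<^sup>2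
      - 2 * Re ((u $ 0 * cnj (v $ 0)) * cnj (u $ 1 * cnj (v $ 1)))"
    unfolding sq[symmetric] by (simp only: witness2_def tensor_mat_def proj_def vec_lambda_beta
        fst_conv snd_conv complex_cnj_mult complex_cnj_cnj mult_ac)
  then show "0 \<le> witness2 (tensor_mat (proj u) (proj v))"
    using Re_mult_cnj_le[of "u $ 0 * cnj (v $ 0)" "u $ 1 * cnj (v $ 1)"]
    unfolding norm_mult complex_mod_cnj by linarith
qed

lemma linear_nonneg_separable:
  assumes "linear W" and W: "\<And>u v. 0 \<le> W (tensor_mat (proj u) (proj v))"
    and "\<rho> \<in> separable_states"
  shows "0 \<le> (W \<rho> :: real)"
proof -
  obtain n :: nat and p :: "nat \<Rightarrow> real" and \<psi> \<chi>' where
    p: "\<forall>i<n. 0 \<le> p i" and \<rho>: "\<rho> = (\<Sum>i<n. p i *\<^sub>R tensor_mat (proj (\<psi> i)) (proj (\<chi>' i)))"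
    using assms(3) unfolding separable_states_def by blast
  have "W \<rho> = (\<Sum>i<n. p i * W (tensor_mat (proj (\<psi> i)) (proj (\<chi>' i))))"
    unfolding \<rho> by (simp add: linear_sum[OF \<open>linear W\<close>] linear_scale[OF \<open>linear W\<close>])
  also have "\<dots> \<ge> 0"
    using p W by (intro sum_nonneg) auto
  finally show ?thesis .
qed

lemmas witness1_separable = linear_nonneg_separable[OF linear_witness1 witness1_product]
lemmas witness2_separable = linear_nonneg_separable[OF linear_witness2 witness2_product]

text \<open>Regrouped, the sum is the expectation of \<open>X\<close> itself in
  \<open>|00> - |11>\<close> plus that in \<open>|01> - |10>\<close>.\<close>

lemma witness_sum_psd:
  assumes "psd X"
  shows "0 \<le> witness1 X + witness2 X"
proof -
  have herm: "X $ q $ p = cnj (X $ p $ q)" for p q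
  proof -
    have "X = conj_transpose X"
      using assms by (simp add: psd_def hermitian_def)
    then have "X $ q $ p = conj_transpose X $ q $ p" by (rule arg_cong)
    then show ?thesis
      by (simp only: conj_transpose_def vec_lambda_beta)
  qed
  have "0 \<le> Re (cinner (ket 0 0 - ket 1 1) (X *v (ket 0 0 - ket 1 1)))"
    and "0 \<le> Re (cinner (ket 0 1 - ket 1 0) (X *v (ket 0 1 - ket 1 0)))"
    using assms by (auto simp: psd_def complex_nonneg_Reals_iff)
  then show ?thesis
    by (simp add: witness1_def witness2_def cinner_def matrix_vector_mult_def sum_2x2 ket_def
        tensor_vec_def axis_def herm[of "(0,0)" "(1,1)"] herm[of "(0,1)" "(1,0)"])
qed

section \<open>Explicit states and a separable mixture\<close>

lemma Phi_components:
  "proj Phi1 $ p $ q = (if fst p = snd p \<and> fst q = snd q then 1 / 2 else 0)"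
  "proj Phi3 $ p $ q = (if fst p \<noteq> snd p \<and> fst q \<noteq> snd q then 1 / 2 else 0)"
proof -
  define c :: complex where "c = of_real (1 / sqrt 2)"
  have c: "c * cnj c = 1 / 2"
    by (simp add: c_def flip: of_real_mult)
  have "Phi1 $ r = (if fst r = snd r then c else 0)"
    "Phi3 $ r = (if fst r \<noteq> snd r then c else 0)" for r
    using cases_2[of "fst r"] cases_2[of "snd r"]
    by (auto simp: c_def Phi1_def Phi3_def ket_def tensor_vec_def axis_def
        scaleR_conv_of_real[where 'a=complex])
  with c show "proj Phi1 $ p $ q = (if fst p = snd p \<and> fst q = snd q then 1 / 2 else 0)"
    "proj Phi3 $ p $ q = (if fst p \<noteq> snd p \<and> fst q \<noteq> snd q then 1 / 2 else 0)"
    by (simp_all add: proj_def)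
qed

lemma proj_ket_component: "proj (ket i j) $ p $ q = (if p = (i, j) \<and> q = (i, j) then 1 else 0)"
  by (cases p; cases q) (auto simp: proj_def ket_def tensor_vec_def axis_def)

lemma separable_mixture:
  fixes p q :: real
  assumes pq: "p\<^sup>2 + q\<^sup>2 = 1"
  shows "(2 * p\<^sup>2 * q\<^sup>2) *\<^sub>R proj Phi1 + p ^ 4 *\<^sub>R proj (ket 0 1) + q ^ 4 *\<^sub>R proj (ket 1 0)
    \<in> separable_states" (is "?M \<in> _")
proof -
  \<comment> \<open>Averaging over the phases \<open>\<i>\<^sup>k\<close> removes all coherences except the one between
      \<open>|00>\<close> and \<open>|11>\<close>.\<close>
  define \<psi> :: "nat \<Rightarrow> qubit_vec"
    where "\<psi> k = (\<chi> i. if i = 0 then of_real p else of_real q * \<i> ^ k)" for k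
  define \<phi> :: "nat \<Rightarrow> qubit_vec"
    where "\<phi> k = (\<chi> i. if i = 0 then of_real q else of_real p * cnj (\<i> ^ k))" for k
  have norm: "norm (\<psi> k) = 1" "norm (\<phi> k) = 1" for k
    using pq by (simp_all add: norm_vec_def L2_set_def UNIV_2_zero_one \<psi>_def \<phi>_def norm_mult norm_power
        add.commute)
  have psd: "psd ?M"
    by (intro psd_add psd_scaleR psd_proj) auto
  have "trace ?M = of_real ((p\<^sup>2 + q\<^sup>2)\<^sup>2)"
    by (simp add: trace_def sum_2x2 Phi_components proj_ket_component
        scaleR_conv_of_real[where 'a=complex])
      (simp add: power2_eq_square power4_eq_xxxx algebra_simps)
  then have tr: "trace ?M = 1"
    by (simp add: pq)
  have i_cube: "\<i> ^ 3 = - \<i>"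
    by (simp add: power3_eq_cube)
  have sum4: "(\<Sum>k<4. f k) = f 0 + f 1 + f 2 + f 3" for f :: "nat \<Rightarrow> two_qubit_mat"
    by (simp add: numeral_eq_Suc)
  \<comment> \<open>The k-th product vector is
    \<open>p q (|00> + |11>) + p^2 \<i>^(-k) |01> + q^2 \<i>^k |10>\<close>. The coherence between
    \<open>|01>\<close> and \<open>|10>\<close> carries the phase squared, so averaging over signs
    alone would not remove it.\<close>
  have decomp: "?M = (\<Sum>k<4. (1/4) *\<^sub>R tensor_mat (proj (\<psi> k)) (proj (\<phi> k)))"
  proof (rule matrix_eq_2x2I)
    fix i j m n :: 2
    show "?M $ (i, j) $ (m, n)
      = (\<Sum>k<4. (1/4) *\<^sub>R tensor_mat (proj (\<psi> k)) (proj (\<phi> k))) $ (i, j) $ (m, n)"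
      unfolding sum4
      using cases_2[of i] cases_2[of j] cases_2[of m] cases_2[of n]
      apply (elim disjE)
      apply (simp_all only: vector_add_component vector_scaleR_component Phi_components
          proj_ket_component)
      apply (simp_all only: tensor_mat_def proj_def \<psi>_def \<phi>_def vec_lambda_beta)
      apply (simp_all only: fst_conv snd_conv zero_neq_one one_neq_zero if_True if_False
          prod.inject simp_thms power_0 power_one_right power2_i i_cube
          complex_cnj_i complex_cnj_minus complex_cnj_one)
      apply (simp_all add: scaleR_conv_of_real[where 'a=complex])
      apply (simp_all add: power2_eq_square power4_eq_xxxx)
      done
  qed
  show ?thesis
    unfolding separable_states_def two_qubit_states_def mem_Collect_eq
  proof (intro conjI psd tr exI)
    show "\<forall>k<4. 0 \<le> (\<lambda>_. 1 / 4 :: real) k"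
      by simp
    show "(\<Sum>k<4::nat. (\<lambda>_. 1 / 4 :: real) k) = 1"
      by simp
    show "\<forall>k<4. norm (\<psi> k) = 1 \<and> norm (\<phi> k) = 1"
      by (simp add: norm)
    show "?M = (\<Sum>k<4. (\<lambda>_. 1 / 4) k *\<^sub>R tensor_mat (proj (\<psi> k)) (proj (\<phi> k)))"
      by (rule decomp)
  qed
qed

theorem theorem1:
  fixes l :: real
  assumes "2 / 3 < l" and "l < 1"
  shows "\<not> (\<exists>\<Lambda>. non_entangling \<Lambda> \<and> \<Lambda> (rho_state l) = sigma_state l)"
proof (rule notI, elim exE conjE)
  fix \<Lambda>
  assume NE: "non_entangling \<Lambda>" and eq: "\<Lambda> (rho_state l) = sigma_state l"
  have lin: "complex_linear \<Lambda>" and cp: "completely_positive \<Lambda>"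
    and sep: "\<And>\<rho>. \<rho> \<in> separable_states \<Longrightarrow> \<Lambda> \<rho> \<in> separable_states"
    using NE by (auto simp: non_entangling_def)
  have add: "\<Lambda> (A + B) = \<Lambda> A + \<Lambda> B" for A B
    using lin by (simp add: complex_linear_def)
  note scale = complex_linear_scaleR[OF lin]
  note w1 = linear_add[OF linear_witness1] linear_scale[OF linear_witness1]
  note w2 = linear_add[OF linear_witness2] linear_scale[OF linear_witness2]
  let ?\<alpha> = "\<Lambda> (proj Phi1)" and ?\<beta> = "\<Lambda> (proj (ket 0 1))" and ?\<gamma> = "\<Lambda> (proj (ket 1 0))"

  \<comment> \<open>At \<open>q = 0\<close> and at \<open>p = 0\<close> the mixture reduces to one
    basis projector.\<close>
  have "proj (ket 0 1) \<in> separable_states" "proj (ket 1 0) \<in> separable_states"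
    using separable_mixture[of 1 0] separable_mixture[of 0 1] by simp_all
  then have \<beta>: "0 \<le> witness1 ?\<beta>" "0 \<le> witness2 ?\<beta>" and \<gamma>: "0 \<le> witness1 ?\<gamma>"
    by (simp_all add: sep witness1_separable witness2_separable)
  have \<alpha>: "0 \<le> witness1 ?\<alpha> + witness2 ?\<alpha>"
    by (rule witness_sum_psd[OF completely_positive_psd[OF cp psd_proj]])

  have \<sigma>: "sigma_state l = l *\<^sub>R ?\<alpha> + (1 - l) *\<^sub>R ?\<beta>"
    using eq unfolding rho_state_def add scale by (rule sym)
  have "witness1 (sigma_state l) = 1 - 2 * l" "witness2 (sigma_state l) = 2 * l - 1"
    by (simp_all add: sigma_state_def witness1_def witness2_def Phi_components field_simps)
  then have s1: "l * witness1 ?\<alpha> + (1 - l) * witness1 ?\<beta> = 1 - 2 * l"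
    and s2: "l * witness2 ?\<alpha> + (1 - l) * witness2 ?\<beta> = 2 * l - 1"
    by (simp_all add: \<sigma> w1 w2)
  \<comment> \<open>The left sides of \<open>s1\<close> and \<open>s2\<close> add up to 0, and these
    are all their contributions except \<open>(1 - l) * witness1 ?\<beta>\<close>.\<close>
  have "0 \<le> l * (witness1 ?\<alpha> + witness2 ?\<alpha>)" "0 \<le> (1 - l) * witness2 ?\<beta>"
    using \<alpha> \<beta> assms by simp_all
  then have "(1 - l) * witness1 ?\<beta> \<le> 0"
    using s1 s2 by (simp add: distrib_left)
  then have \<beta>0: "witness1 ?\<beta> = 0"
    using \<beta> assms by (simp add: mult_le_0_iff)
  then have "l * witness1 ?\<alpha> < 0"
    using s1 assms by simp
  then have \<alpha>_neg: "witness1 ?\<alpha> < 0"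
    using assms by (simp add: mult_less_0_iff)

  \<comment> \<open>An explicit ratio \<open>q^2 / p^2\<close> replaces the limit: it must be so
    small that \<open>2 * witness1 ?\<alpha> + t * witness1 ?\<gamma>\<close> stays negative. The
    added 1 keeps the denominator positive if \<open>witness1 ?\<gamma>\<close> vanishes.\<close>
  define t where "t = - witness1 ?\<alpha> / (witness1 ?\<gamma> + 1)"
  have t: "0 < t" "t * witness1 ?\<gamma> < - 2 * witness1 ?\<alpha>"
  proof -
    show "0 < t"
      using \<alpha>_neg \<gamma> by (simp add: t_def divide_neg_pos)
    \<comment> \<open>This is the second bound on \<open>t\<close> after clearing the
      denominator.\<close>
    have "witness1 ?\<alpha> * (witness1 ?\<gamma> + 2) < 0"
      using \<alpha>_neg \<gamma> by (intro mult_neg_pos) auto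
    then show "t * witness1 ?\<gamma> < - 2 * witness1 ?\<alpha>"
      using \<gamma> by (simp add: t_def field_simps)
  qed
  define p q where "p = sqrt (1 / (1 + t))" and "q = sqrt (t / (1 + t))"
  have p2: "p\<^sup>2 = 1 / (1 + t)" and q2: "q\<^sup>2 = t * p\<^sup>2"
    using t by (simp_all add: p_def q_def)
  have "p\<^sup>2 + q\<^sup>2 = 1"
    using t by (simp add: q2 p2 add_divide_distrib[symmetric])
  from witness1_separable[OF sep[OF separable_mixture[OF this]]]
  have "0 \<le> 2 * p\<^sup>2 * q\<^sup>2 * witness1 ?\<alpha> + q ^ 4 * witness1 ?\<gamma>"
    by (simp add: add scale w1 \<beta>0)
  also have "\<dots> = q\<^sup>2 * p\<^sup>2 * (2 * witness1 ?\<alpha> + t * witness1 ?\<gamma>)"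
  proof -
    have "q ^ 4 = q\<^sup>2 * (t * p\<^sup>2)"
      unfolding q2[symmetric] by (simp flip: power_add)
    then show ?thesis
      by (simp add: algebra_simps)
  qed
  also have "\<dots> < 0"
    using t by (intro mult_pos_neg) (auto simp: q2 p2)
  finally show False by simp
qed

end
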